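(* Let $F\in C^2(\mathbb{R})$ satisfy \[ \mathrm{Argmin}(F)=\{0\},\qquad \liminf_{|t|\to+\infty}\frac{F(t)}{t^2}>0,\qquad F''(0)=0 . \] Then, for any $q>0$, there is a nontrivial periodic solution $u_q:\mathbb{R}\to\mathbb{R}$ to \[ u''''+qu''+F'(u)=0, \] and these solutions satisfy $\lim_{q\downarrow 0}\|u_q\|_{\infty}=0$.
   Context: $\mathrm{Argmin}(F)$ is the set of global minimum points of $F$ on $\mathbb{R}$. A solution is a $C^4$ function $u:\mathbb{R}\to\mathbb{R}$ satisfying the equation at every point of $\mathbb{R}$; it is called nontrivial if it is non-constant. $\|\cdot\|_\infty$ is the supremum norm on $\mathbb{R}$. *)

theory Defs
  imports "HOL-Analysis.Analysis"
begin

definition C_k :: "nat \<Rightarrow> (real \<Rightarrow> real) \<Rightarrow> bool" where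
  "C_k k f \<longleftrightarrow>
     (\<forall>i<k. (deriv ^^ i) f differentiable_on UNIV) \<and> continuous_on UNIV ((deriv ^^ k) f)"

definition Argmin :: "(real \<Rightarrow> real) \<Rightarrow> real set" where
  "Argmin F = {x. is_arg_min F (\<lambda>_. True) x}"

definition is_solution :: "(real \<Rightarrow> real) \<Rightarrow> real \<Rightarrow> (real \<Rightarrow> real) \<Rightarrow> bool" where
  "is_solution F q u \<longleftrightarrow>
     C_k 4 u \<and> (\<forall>x. (deriv ^^ 4) u x + q * (deriv ^^ 2) u x + deriv F (u x) = 0)"

definition nontrivial :: "(real \<Rightarrow> real) \<Rightarrow> bool" where
  "nontrivial u \<longleftrightarrow> \<not> u constant_on UNIV"

definition periodic :: "(real \<Rightarrow> real) \<Rightarrow> bool" where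
  "periodic u \<longleftrightarrow> (\<exists>T>0. \<forall>x. u (x + T) = u x)"

text \<open>The supremum is taken in the reals, so the value is the supremum norm only for bounded
  functions; continuous periodic functions are bounded.\<close>

definition sup_norm :: "(real \<Rightarrow> real) \<Rightarrow> real" where
  "sup_norm u = (SUP x. \<bar>u x\<bar>)"

end

theory Submission
  imports Defs
begin

text \<open>
  Small periodic solutions are found near the cosine solutions of the equation linearised at \<open>0\<close> by
  a Lyapunov--Schmidt reduction. Put \<open>u x = a + r * \<phi> (\<omega> * x)\<close> with \<open>\<phi>\<close> even and \<open>2\<pi>\<close>-periodic. Since
  \<open>F''\<close> vanishes at \<open>0\<close>, the increment \<open>f y = (F' (a + r y) - F' a) / r\<close> has an arbitrarily small
  Lipschitz constant for small \<open>a\<close> and \<open>r\<close>. Hence, for each \<open>a\<close>, the equation modulo constants is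
  solved by a contraction, which yields \<open>\<phi>\<close> close to \<open>cos\<close> together with the frequency \<open>\<omega>\<close>. What remains
  is the scalar equation \<open>F' a + r * average (f \<circ> \<phi>) = 0\<close>. Its second term is as small as desired and
  continuous in \<open>a\<close>, while \<open>F'\<close> takes both signs near the strict minimum \<open>0\<close>, so the intermediate value
  theorem provides \<open>a\<close>. The amplitude can be chosen below any bound, in particular below \<open>q\<close>.
\<close>

section \<open>Primitives of periodic functions\<close>

text \<open>The two cases form the oriented integral from 0 to \<open>s\<close>; for negative
  \<open>s\<close> the interval \<open>{0..s}\<close> is empty, so the first formula alone would
  give 0 there.\<close>

definition primitive :: "(real \<Rightarrow> real) \<Rightarrow> real \<Rightarrow> real" where
  "primitive g s = (if 0 \<le> s then integral {0..s} g else - integral {s..0} g)"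

lemma primitive_0 [simp]: "primitive g 0 = 0"
  by (simp add: primitive_def)

text \<open>Moving the base point to the left of \<open>s\<close> replaces the case distinction by
  one formula that is valid around 0 as well, so the fundamental theorem of calculus applies at
  every point.\<close>

lemma primitive_eq_diff:
  assumes "continuous_on UNIV g" and "c \<ge> 0" and "- c \<le> s"
  shows "primitive g s = integral {-c..s} g - integral {-c..0} g"
proof (cases "0 \<le> s")
  case True
  have "integral {-c..0} g + integral {0..s} g = integral {-c..s} g"
    using assms True
    by (intro Henstock_Kurzweil_Integration.integral_combine integrable_continuous_real)
      (auto intro: continuous_on_subset)
  with True show ?thesis by (simp add: primitive_def)
next
  case False
  have "integral {-c..s} g + integral {s..0} g = integral {-c..0} g"
    using assms False
    by (intro Henstock_Kurzweil_Integration.integral_combine integrable_continuous_real)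
      (auto intro: continuous_on_subset)
  with False show ?thesis by (simp add: primitive_def)
qed

lemma has_real_derivative_primitive:
  assumes g: "continuous_on UNIV g"
  shows "(primitive g has_real_derivative g x) (at x)"
proof -
  define c where "c = \<bar>x\<bar> + 1"
  have x: "x \<in> {-c<..<c}" and c: "c \<ge> 0"
    by (auto simp: c_def)
  have "((\<lambda>u. integral {-c..u} g) has_real_derivative g x) (at x within {-c..c})"
    using g x by (intro integral_has_real_derivative) (auto intro: continuous_on_subset)
  then have "((\<lambda>u. integral {-c..u} g) has_real_derivative g x) (at x)"
    using x at_within_interior[of x "{-c..c}"] by (simp add: interior_atLeastAtMost_real)
  then have "((\<lambda>u. integral {-c..u} g - integral {-c..0} g) has_real_derivative g x) (at x)"
    by (auto intro!: derivative_eq_intros)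
  then show ?thesis
  proof (rule has_field_derivative_transform_within_open)
    show "integral {-c..u} g - integral {-c..0} g = primitive g u" if "u \<in> {-c<..<c}" for u
      using that g c by (subst primitive_eq_diff[of g c]) auto
  qed (use x in auto)
qed

lemma has_real_derivative_primitive_comp [derivative_intros]:
  assumes "continuous_on UNIV g" and "(h has_real_derivative h') (at x within S)"
    and "g (h x) * h' = d"
  shows "((\<lambda>x. primitive g (h x)) has_real_derivative d) (at x within S)"
  using DERIV_chain2[OF has_real_derivative_primitive[OF assms(1)] assms(2)] assms(3) by simp

lemma continuous_on_primitive:
  assumes "continuous_on UNIV g"
  shows "continuous_on UNIV (primitive g)"
  using has_real_derivative_primitive[OF assms]
  by (meson DERIV_isCont continuous_at_imp_continuous_on)

lemma primitive_diff_bound: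
  assumes "continuous_on UNIV f" and "continuous_on UNIV g" and "\<And>x. \<bar>f x - g x\<bar> \<le> M"
  shows "\<bar>primitive f s - primitive g s\<bar> \<le> M * \<bar>s\<bar>"
proof -
  have "norm ((primitive f s - primitive g s) - (primitive f 0 - primitive g 0)) \<le> M * norm (s - 0)"
    by (rule field_differentiable_bound[where S = UNIV and f' = "\<lambda>x. f x - g x"])
      (use assms in \<open>auto intro!: derivative_eq_intros\<close>)
  then show ?thesis by simp
qed

text \<open>Both sides agree at 0 and have the same derivative. The later identities between
  primitives are also obtained from a difference with zero derivative.\<close>

lemma primitive_uminus:
  assumes "continuous_on UNIV g" and "\<And>x. g (-x) = \<sigma> * g x"
  shows "primitive g (-x) = - \<sigma> * primitive g x"
proof -
  let ?d = "\<lambda>x. primitive g (-x) + \<sigma> * primitive g x"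
  have "(?d has_real_derivative 0) (at x)" for x
    using assms by (auto intro!: derivative_eq_intros)
  then have "\<forall>x. (?d has_real_derivative 0) (at x)" by blast
  from DERIV_isconst_all[OF this, of x 0] show ?thesis by simp
qed

text \<open>The parameter \<open>\<sigma>\<close> is \<open>1\<close> for even and \<open>-1\<close> for odd functions.\<close>

definition periodic_parity :: "real \<Rightarrow> (real \<Rightarrow> real) \<Rightarrow> bool" where
  "periodic_parity \<sigma> f \<longleftrightarrow>
     continuous_on UNIV f \<and> (\<forall>x. f (- x) = \<sigma> * f x) \<and> (\<forall>x. f (x + 2 * pi) = f x)"

lemma periodic_parityD:
  assumes "periodic_parity \<sigma> f"
  shows "continuous_on UNIV f" and "f (- x) = \<sigma> * f x" and "f (x + 2 * pi) = f x"
  using assms by (auto simp: periodic_parity_def)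

lemma periodic_parity_cos: "periodic_parity 1 cos"
  and periodic_parity_sin: "periodic_parity (-1) sin"
  by (auto simp: periodic_parity_def intro!: continuous_intros)

lemma periodic_parity_const: "periodic_parity 1 (\<lambda>x. c)"
  by (auto simp: periodic_parity_def)

lemma periodic_parity_add:
  "periodic_parity \<sigma> f \<Longrightarrow> periodic_parity \<sigma> g \<Longrightarrow> periodic_parity \<sigma> (\<lambda>x. f x + g x)"
  by (auto simp: periodic_parity_def algebra_simps intro!: continuous_intros)

lemma periodic_parity_diff:
  "periodic_parity \<sigma> f \<Longrightarrow> periodic_parity \<sigma> g \<Longrightarrow> periodic_parity \<sigma> (\<lambda>x. f x - g x)"
  by (auto simp: periodic_parity_def algebra_simps intro!: continuous_intros)

lemma periodic_parity_mult:
  "periodic_parity \<sigma> f \<Longrightarrow> periodic_parity \<tau> g \<Longrightarrow> \<sigma> * \<tau> = \<rho> \<Longrightarrow> periodic_parity \<rho> (\<lambda>x. f x * g x)"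
  by (auto simp: periodic_parity_def algebra_simps intro!: continuous_intros)

lemma periodic_parity_comp:
  "periodic_parity 1 f \<Longrightarrow> continuous_on UNIV F \<Longrightarrow> periodic_parity 1 (\<lambda>x. F (f x))"
  by (auto simp: periodic_parity_def intro: continuous_on_compose2)

section \<open>Periodicity of primitives and bounds uniform on the line\<close>

lemma primitive_add_period:
  assumes "continuous_on UNIV g" and "\<And>x. g (x + 2 * pi) = g x"
  shows "primitive g (x + 2 * pi) = primitive g x + primitive g (2 * pi)"
proof -
  let ?d = "\<lambda>x. primitive g (x + 2 * pi) - primitive g x"
  have "(?d has_real_derivative 0) (at x)" for x
    using assms by (auto intro!: derivative_eq_intros)
  then have "\<forall>x. (?d has_real_derivative 0) (at x)" by blast
  from DERIV_isconst_all[OF this, of x 0] show ?thesis by simp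
qed

lemma periodic_parity_primitive:
  assumes "periodic_parity \<sigma> g" and "primitive g (2 * pi) = 0"
  shows "periodic_parity (-\<sigma>) (primitive g)"
  using assms continuous_on_primitive primitive_uminus primitive_add_period
  unfolding periodic_parity_def by auto

text \<open>The primitive of an odd function is even, so it agrees at \<open>-pi\<close> and
  \<open>pi\<close>, which are one period apart.\<close>

lemma primitive_odd_period:
  assumes "periodic_parity (-1) g"
  shows "primitive g (2 * pi) = 0"
  using primitive_add_period[of g "-pi"] primitive_uminus[of g "-1" pi] periodic_parityD[OF assms]
  by simp

text \<open>The bound \<open>M * \<bar>s\<bar>\<close> grows with \<open>s\<close>. Since both
  integrals over a period vanish, the difference of the primitives is periodic and \<open>s\<close>
  can be moved into \<open>{0..2 * pi}\<close>; the 7 is an upper bound for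
  \<open>2 * pi\<close>.\<close>

lemma periodic_primitive_diff_bound:
  assumes "periodic_parity \<sigma> f" and "periodic_parity \<tau> g"
    and "primitive f (2 * pi) = 0" and "primitive g (2 * pi) = 0"
    and le: "\<And>x. \<bar>f x - g x\<bar> \<le> M"
  shows "\<bar>primitive f s - primitive g s\<bar> \<le> 7 * M"
proof -
  define d where "d s = primitive f s - primitive g s" for s
  define n where "n = \<lfloor>s / (2 * pi)\<rfloor>"
  have M: "M \<ge> 0"
    using le[of 0] by linarith
  have per: "d (x + 2 * pi) = d x" for x
    using primitive_add_period[of f x] primitive_add_period[of g x] assms
    by (simp add: d_def periodic_parity_def)
  have per_nat: "d (x + real k * (2 * pi)) = d x" for x k
  proof (induction k)
    case (Suc k)
    then show ?case
      using per[of "x + real k * (2 * pi)"] by (simp add: algebra_simps)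
  qed simp
  have per_int: "d (x + of_int k * (2 * pi)) = d x" for x k
  proof (cases "k \<ge> 0")
    case True
    then show ?thesis using per_nat[of x "nat k"] by simp
  next
    case False
    then show ?thesis using per_nat[of "x + of_int k * (2 * pi)" "nat (-k)"] by simp
  qed
  define t where "t = s - of_int n * (2 * pi)"
  have "of_int n \<le> s / (2 * pi)" and "s / (2 * pi) < of_int n + 1"
    unfolding n_def by linarith+
  then have t: "0 \<le> t" "t \<le> 2 * pi"
    by (auto simp: t_def field_simps)
  have "\<bar>d t\<bar> \<le> M * \<bar>t\<bar>"
    unfolding d_def using assms by (intro primitive_diff_bound) (auto simp: periodic_parity_def)
  also have "\<dots> \<le> M * 7"
    using t M pi_less_4 pi_approx by (intro mult_left_mono) auto
  finally show ?thesis
    using per_int[of t n] by (simp add: t_def d_def)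
qed

lemma periodic_primitive_bound:
  assumes "periodic_parity \<sigma> f" and "primitive f (2 * pi) = 0" and "\<And>x. \<bar>f x\<bar> \<le> M"
  shows "\<bar>primitive f s\<bar> \<le> 7 * M"
proof -
  have "primitive (\<lambda>_. 0) s = 0" for s
    by (simp add: primitive_def)
  then show ?thesis
    using periodic_primitive_diff_bound[OF assms(1) periodic_parity_const[of 0] assms(2), of M s] assms(3)
    by simp
qed

section \<open>The reduced equation\<close>

definition average :: "(real \<Rightarrow> real) \<Rightarrow> real" where
  "average p = primitive p (2 * pi) / (2 * pi)"

text \<open>
  A profile \<open>\<phi>\<close> of frequency \<open>\<omega>\<close> has to satisfy \<open>\<phi>'''' + b \<phi>'' + (b\<^sup>2 / q\<^sup>2) (p - average p) = 0\<close>, where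
  \<open>b = q / \<omega>\<^sup>2\<close> and \<open>p = f \<circ> \<phi>\<close>. Normalising the amplitude by \<open>\<phi> 0 = b\<close> encodes the unknown frequency
  in the profile itself. Two integrations turn the equation into \<open>\<phi>'' + \<phi> = - source\<close>, in which
  \<open>shift\<close> plays the role of \<open>b - 1\<close> and is determined by the solvability condition that \<open>source\<close> is
  orthogonal to \<open>cos\<close>; \<open>reduced_map\<close> is variation of constants.
\<close>

definition double_primitive :: "(real \<Rightarrow> real) \<Rightarrow> real \<Rightarrow> real" where
  "double_primitive p = primitive (primitive (\<lambda>t. p t - average p))"

definition forcing :: "real \<Rightarrow> (real \<Rightarrow> real) \<Rightarrow> (real \<Rightarrow> real) \<Rightarrow> real \<Rightarrow> real" where
  "forcing q \<phi> p t = (\<phi> 0)\<^sup>2 / q\<^sup>2 * double_primitive p t"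

definition shift :: "real \<Rightarrow> (real \<Rightarrow> real) \<Rightarrow> (real \<Rightarrow> real) \<Rightarrow> real" where
  "shift q \<phi> p =
     - (primitive (\<lambda>t. cos t * forcing q \<phi> p t) (2 * pi) / primitive (\<lambda>t. cos t * \<phi> t) (2 * pi))"

definition source :: "real \<Rightarrow> (real \<Rightarrow> real) \<Rightarrow> (real \<Rightarrow> real) \<Rightarrow> real \<Rightarrow> real" where
  "source q \<phi> p t = shift q \<phi> p * \<phi> t + forcing q \<phi> p t"

definition reduced_map :: "real \<Rightarrow> (real \<Rightarrow> real) \<Rightarrow> (real \<Rightarrow> real) \<Rightarrow> real \<Rightarrow> real" where
  "reduced_map q \<phi> p s = (1 + shift q \<phi> p) * cos s
     - sin s * primitive (\<lambda>t. cos t * source q \<phi> p t) s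
     + cos s * primitive (\<lambda>t. sin t * source q \<phi> p t) s"

definition near_cos :: "(real \<Rightarrow> real) \<Rightarrow> bool" where
  "near_cos \<phi> \<longleftrightarrow> periodic_parity 1 \<phi> \<and> (\<forall>x. \<bar>\<phi> x - cos x\<bar> \<le> 1/4)"

text \<open>The constant 2400000 is large enough for \<open>reduced_map\<close> to contract by the factor \<open>1/2\<close>.\<close>

definition small_even :: "real \<Rightarrow> (real \<Rightarrow> real) \<Rightarrow> bool" where
  "small_even q p \<longleftrightarrow> periodic_parity 1 p \<and> (\<forall>x. \<bar>p x\<bar> \<le> 2 * (q\<^sup>2 / 2400000))"

lemma near_cosD:
  assumes "near_cos \<phi>"
  shows "periodic_parity 1 \<phi>" and "\<bar>\<phi> x - cos x\<bar> \<le> 1/4" and "\<bar>\<phi> x\<bar> \<le> 5/4"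
proof -
  show "periodic_parity 1 \<phi>" and *: "\<bar>\<phi> x - cos x\<bar> \<le> 1/4"
    using assms by (auto simp: near_cos_def)
  show "\<bar>\<phi> x\<bar> \<le> 5/4"
    using * abs_cos_le_one[of x] by linarith
qed

lemma small_evenD:
  assumes "small_even q p"
  shows "periodic_parity 1 p" and "\<bar>p x\<bar> \<le> 2 * (q\<^sup>2 / 2400000)"
  using assms by (auto simp: small_even_def)

section \<open>Averages, double primitives and the first Fourier coefficient\<close>

lemma abs_mult_diff_le:
  fixes a b c d :: real
  assumes "\<bar>a\<bar> \<le> A" and "\<bar>d\<bar> \<le> B" and "\<bar>a - c\<bar> \<le> M" and "\<bar>b - d\<bar> \<le> N"
  shows "\<bar>a * b - c * d\<bar> \<le> A * N + M * B"
proof -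
  have "\<bar>a * b - c * d\<bar> = \<bar>a * (b - d) + (a - c) * d\<bar>"
    by (simp add: algebra_simps)
  also have "\<dots> \<le> \<bar>a\<bar> * \<bar>b - d\<bar> + \<bar>a - c\<bar> * \<bar>d\<bar>"
    by (metis abs_triangle_ineq abs_mult)
  also have "\<dots> \<le> A * N + M * B"
    using assms by (intro add_mono mult_mono) auto
  finally show ?thesis .
qed

lemma abs_mult_le_right:
  fixes a b :: real
  assumes "\<bar>a\<bar> \<le> 1" and "\<bar>b\<bar> \<le> M"
  shows "\<bar>a * b\<bar> \<le> M"
  using mult_mono[OF assms] by (simp add: abs_mult)

lemma average_diff_bound:
  assumes "continuous_on UNIV f" and "continuous_on UNIV g" and "\<And>x. \<bar>f x - g x\<bar> \<le> M"
  shows "\<bar>average f - average g\<bar> \<le> M"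
proof -
  have "\<bar>primitive f (2 * pi) - primitive g (2 * pi)\<bar> \<le> M * (2 * pi)"
    using primitive_diff_bound[OF assms, of "2 * pi"] by simp
  then show ?thesis
    by (simp add: average_def flip: diff_divide_distrib add: abs_divide pos_divide_le_eq)
qed

lemma average_const: "average (\<lambda>_. 0) = 0"
  by (simp add: average_def primitive_def)

lemma average_bound:
  assumes "continuous_on UNIV f" and "\<And>x. \<bar>f x\<bar> \<le> M"
  shows "\<bar>average f\<bar> \<le> M"
  using average_diff_bound[OF assms(1), of "\<lambda>_. 0" M] assms(2) by (simp add: average_const)

lemma primitive_sub_const:
  assumes "continuous_on UNIV p"
  shows "primitive (\<lambda>t. p t - c) s = primitive p s - c * s"
proof -
  let ?d = "\<lambda>s. primitive (\<lambda>t. p t - c) s - (primitive p s - c * s)"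
  have "(?d has_real_derivative 0) (at x)" for x
    using assms by (auto intro!: derivative_eq_intros continuous_intros)
  then have "\<forall>x. (?d has_real_derivative 0) (at x)" by blast
  from DERIV_isconst_all[OF this, of s 0] show ?thesis by simp
qed

lemma primitive_sub_average:
  assumes "continuous_on UNIV p"
  shows "primitive (\<lambda>t. p t - average p) (2 * pi) = 0"
  using assms by (simp add: primitive_sub_const average_def)

text \<open>Removing the mean makes the first primitive periodic. This primitive is odd, so its own
  mean is already zero and the second primitive is periodic without a further correction.\<close>

lemma periodic_parity_sub_average:
  assumes "periodic_parity 1 p"
  shows "periodic_parity 1 (\<lambda>t. p t - average p)"
    and "periodic_parity (-1) (primitive (\<lambda>t. p t - average p))"
    and "primitive (primitive (\<lambda>t. p t - average p)) (2 * pi) = 0"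
    and "periodic_parity 1 (double_primitive p)"
proof -
  show 1: "periodic_parity 1 (\<lambda>t. p t - average p)"
    using assms by (intro periodic_parity_diff periodic_parity_const)
  show 2: "periodic_parity (-1) (primitive (\<lambda>t. p t - average p))"
    by (rule periodic_parity_primitive[OF 1 primitive_sub_average]) (use assms periodic_parityD in blast)
  show 3: "primitive (primitive (\<lambda>t. p t - average p)) (2 * pi) = 0"
    by (rule primitive_odd_period[OF 2])
  show "periodic_parity 1 (double_primitive p)"
    using periodic_parity_primitive[OF 2 3] by (simp add: double_primitive_def)
qed

text \<open>The factor 98 is 7 * 7 * 2: subtracting the averages at most doubles the bound, and each
  of the two integrations costs a factor 7.\<close>

lemma double_primitive_diff_bound:
  assumes f: "periodic_parity 1 f" and g: "periodic_parity 1 g" and le: "\<And>x. \<bar>f x - g x\<bar> \<le> M"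
  shows "\<bar>double_primitive f s - double_primitive g s\<bar> \<le> 98 * M"
proof -
  note [simp] = periodic_parityD(1)[OF f] periodic_parityD(1)[OF g]
  have "\<bar>(f x - average f) - (g x - average g)\<bar> \<le> 2 * M" for x
    using le[of x] average_diff_bound[of f g M, OF _ _ le] by (simp add: abs_le_iff)
  then have "\<bar>primitive (\<lambda>t. f t - average f) x - primitive (\<lambda>t. g t - average g) x\<bar> \<le> 7 * (2 * M)" for x
    by (intro periodic_primitive_diff_bound[where \<sigma> = 1 and \<tau> = 1] periodic_parity_sub_average
        primitive_sub_average f g) auto
  then have "\<bar>double_primitive f s - double_primitive g s\<bar> \<le> 7 * (7 * (2 * M))"
    unfolding double_primitive_def
    by (intro periodic_primitive_diff_bound[OF periodic_parity_sub_average(2)[OF f]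
          periodic_parity_sub_average(2)[OF g]] periodic_parity_sub_average(3) f g)
  then show ?thesis by simp
qed

lemma double_primitive_bound:
  assumes "periodic_parity 1 f" and "\<And>x. \<bar>f x\<bar> \<le> M"
  shows "\<bar>double_primitive f s\<bar> \<le> 98 * M"
proof -
  have "primitive (\<lambda>_. 0) = (\<lambda>_. 0)"
    by (auto simp: primitive_def)
  then have "double_primitive (\<lambda>_. 0) s = 0"
    by (simp add: double_primitive_def average_const)
  then show ?thesis
    using double_primitive_diff_bound[OF assms(1) periodic_parity_const[of 0], of M s] assms(2) by simp
qed

lemma primitive_cos_sq: "primitive (\<lambda>t. cos t * cos t) (2 * pi) = pi"
proof -
  let ?d = "\<lambda>s. primitive (\<lambda>t. cos t * cos t) s - (s / 2 + sin s * cos s / 2)"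
  have "(?d has_real_derivative 0) (at x)" for x
    using sin_cos_squared_add[of x]
    by (auto intro!: derivative_eq_intros continuous_intros simp: field_simps power2_eq_square)
  then have "\<forall>x. (?d has_real_derivative 0) (at x)" by blast
  from DERIV_isconst_all[OF this, of "2 * pi" 0] show ?thesis by simp
qed

text \<open>For \<open>cos\<close> itself the value is \<open>pi\<close>, and a deviation of 1/4
  changes it by at most \<open>pi / 2\<close>. This keeps the denominator of \<open>shift\<close>
  away from 0.\<close>

lemma primitive_cos_lower:
  assumes "near_cos \<phi>"
  shows "primitive (\<lambda>t. cos t * \<phi> t) (2 * pi) \<ge> 3/2"
proof -
  have "\<bar>cos x * \<phi> x - cos x * cos x\<bar> \<le> 1/4" for x
    using abs_mult_le_right[of "cos x" "\<phi> x - cos x" "1/4"] near_cosD(2)[OF assms, of x]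
    by (simp add: right_diff_distrib)
  then have "\<bar>primitive (\<lambda>t. cos t * \<phi> t) (2 * pi) - primitive (\<lambda>t. cos t * cos t) (2 * pi)\<bar>
      \<le> 1/4 * \<bar>2 * pi\<bar>"
    using near_cosD(1)[OF assms]
    by (intro primitive_diff_bound) (auto intro!: continuous_intros simp: periodic_parity_def)
  then show ?thesis
    using pi_gt3 unfolding primitive_cos_sq by linarith
qed

lemma period_integral_diff_bound:
  assumes "continuous_on UNIV f" and "continuous_on UNIV g" and "\<And>x. \<bar>f x - g x\<bar> \<le> M"
  shows "\<bar>primitive f (2 * pi) - primitive g (2 * pi)\<bar> \<le> 7 * M"
proof -
  have "M \<ge> 0"
    using assms(3)[of 0] by linarith
  have "\<bar>primitive f (2 * pi) - primitive g (2 * pi)\<bar> \<le> M * \<bar>2 * pi\<bar>"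
    by (rule primitive_diff_bound[OF assms])
  also have "\<dots> \<le> M * 7"
    using \<open>M \<ge> 0\<close> pi_approx by (intro mult_left_mono) auto
  finally show ?thesis by simp
qed

lemma period_integral_bound:
  assumes "continuous_on UNIV f" and "\<And>x. \<bar>f x\<bar> \<le> M"
  shows "\<bar>primitive f (2 * pi)\<bar> \<le> 7 * M"
  using period_integral_diff_bound[OF assms(1), of "\<lambda>_. 0" M] assms(2)
  by (simp add: primitive_def)

section \<open>Symmetry and solvability of the linear problem\<close>

lemma periodic_parity_forcing: "periodic_parity 1 p \<Longrightarrow> periodic_parity 1 (forcing q \<phi> p)"
  unfolding forcing_def
  by (intro periodic_parity_mult[where \<sigma> = 1 and \<tau> = 1] periodic_parity_const periodic_parity_sub_average) auto

lemma periodic_parity_source: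
  assumes "near_cos \<phi>" and "periodic_parity 1 p"
  shows "periodic_parity 1 (source q \<phi> p)"
  unfolding source_def
  by (intro periodic_parity_add periodic_parity_forcing assms
      periodic_parity_mult[OF periodic_parity_const near_cosD(1)[OF assms(1)]]) simp

lemma primitive_linear:
  assumes "continuous_on UNIV f" and "continuous_on UNIV g"
  shows "primitive (\<lambda>t. c * f t + g t) s = c * primitive f s + primitive g s"
proof -
  let ?d = "\<lambda>s. primitive (\<lambda>t. c * f t + g t) s - (c * primitive f s + primitive g s)"
  have "(?d has_real_derivative 0) (at x)" for x
    using assms by (auto intro!: derivative_eq_intros continuous_intros)
  then have "\<forall>x. (?d has_real_derivative 0) (at x)" by blast
  from DERIV_isconst_all[OF this, of s 0] show ?thesis by simp
qed

text \<open>\<open>shift\<close> is the solution of this linear equation, whose leading coefficient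
  is at least 3/2. The condition excludes resonance: it makes the primitive of
  \<open>cos t * source q \<phi> p t\<close> periodic, while for the factor \<open>sin t\<close>
  oddness suffices.\<close>

lemma source_orthogonal_cos:
  assumes "near_cos \<phi>" and "periodic_parity 1 p"
  shows "primitive (\<lambda>t. cos t * source q \<phi> p t) (2 * pi) = 0"
proof -
  have "(\<lambda>t. cos t * source q \<phi> p t) =
      (\<lambda>t. shift q \<phi> p * (cos t * \<phi> t) + cos t * forcing q \<phi> p t)"
    by (simp add: source_def algebra_simps)
  moreover have "primitive (\<lambda>t. shift q \<phi> p * (cos t * \<phi> t) + cos t * forcing q \<phi> p t) (2 * pi)
      = shift q \<phi> p * primitive (\<lambda>t. cos t * \<phi> t) (2 * pi)
        + primitive (\<lambda>t. cos t * forcing q \<phi> p t) (2 * pi)"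
    using near_cosD(1)[OF assms(1)] periodic_parity_forcing[OF assms(2)]
    by (intro primitive_linear) (auto intro!: continuous_intros simp: periodic_parity_def)
  ultimately show ?thesis
    using primitive_cos_lower[OF assms(1)] by (simp add: shift_def)
qed

lemma source_cos_sin:
  assumes "near_cos \<phi>" and "periodic_parity 1 p"
  shows "periodic_parity 1 (\<lambda>t. cos t * source q \<phi> p t)"
    and "periodic_parity (-1) (\<lambda>t. sin t * source q \<phi> p t)"
    and "primitive (\<lambda>t. sin t * source q \<phi> p t) (2 * pi) = 0"
proof -
  show "periodic_parity 1 (\<lambda>t. cos t * source q \<phi> p t)"
    by (rule periodic_parity_mult[OF periodic_parity_cos periodic_parity_source[OF assms]]) simp
  show *: "periodic_parity (-1) (\<lambda>t. sin t * source q \<phi> p t)"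
    by (rule periodic_parity_mult[OF periodic_parity_sin periodic_parity_source[OF assms]]) simp
  show "primitive (\<lambda>t. sin t * source q \<phi> p t) (2 * pi) = 0"
    by (rule primitive_odd_period[OF *])
qed

lemma periodic_parity_reduced_map:
  assumes "near_cos \<phi>" and "periodic_parity 1 p"
  shows "periodic_parity 1 (reduced_map q \<phi> p)"
  unfolding reduced_map_def
  by (intro periodic_parity_add periodic_parity_diff
      periodic_parity_mult[OF periodic_parity_const periodic_parity_cos]
      periodic_parity_mult[OF periodic_parity_sin periodic_parity_primitive[OF
          source_cos_sin(1)[OF assms] source_orthogonal_cos[OF assms]]]
      periodic_parity_mult[OF periodic_parity_cos periodic_parity_primitive[OF
          source_cos_sin(2)[OF assms] source_cos_sin(3)[OF assms]]]) auto

section \<open>Quantitative estimates for the contraction\<close>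

lemma forcing_bound:
  assumes q: "q > 0" and \<phi>: "near_cos \<phi>" and p: "small_even q p"
  shows "\<bar>forcing q \<phi> p t\<bar> \<le> 1/2000"
proof -
  have "\<bar>double_primitive p t\<bar> \<le> 98 * (2 * (q\<^sup>2 / 2400000))"
    using p by (intro double_primitive_bound small_evenD)
  moreover have "\<bar>(\<phi> 0)\<^sup>2 / q\<^sup>2\<bar> \<le> 4 / q\<^sup>2"
    using abs_le_square_iff[of "\<phi> 0" 2] near_cosD(3)[OF \<phi>, of 0] by (simp add: divide_right_mono)
  ultimately have "\<bar>forcing q \<phi> p t\<bar> \<le> 4 / q\<^sup>2 * (98 * (2 * (q\<^sup>2 / 2400000)))"
    unfolding forcing_def abs_mult by (intro mult_mono) auto
  then show ?thesis
    using q by (simp add: field_simps)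
qed

context
  fixes q D :: real and \<phi> \<psi> f g :: "real \<Rightarrow> real"
  assumes q: "q > 0" and \<phi>: "near_cos \<phi>" and \<psi>: "near_cos \<psi>"
    and f: "small_even q f" and g: "small_even q g"
    and diff: "\<And>x. \<bar>\<phi> x - \<psi> x\<bar> \<le> D" "\<And>x. \<bar>f x - g x\<bar> \<le> q\<^sup>2 / 2400000 * D"
begin

lemma distance_nonneg: "D \<ge> 0"
  using diff(1)[of 0] by linarith

text \<open>In this context \<open>f\<close> and \<open>g\<close> are nonlinear terms already
  composed with the profiles, and they may come from different nonlinearities. The estimates
  therefore serve both the contraction and the dependence of its fixed point on the nonlinearity.
  The factor \<open>q\<^sup>2\<close> in the assumptions cancels the denominator of
  \<open>forcing\<close>.\<close>

lemma forcing_diff: "\<bar>forcing q \<phi> f t - forcing q \<psi> g t\<bar> \<le> D / 2000"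
proof -
  have "\<bar>\<phi> 0 * \<phi> 0 - \<psi> 0 * \<psi> 0\<bar> \<le> 5/4 * D + D * (5/4)"
    by (intro abs_mult_diff_le near_cosD \<phi> \<psi> diff)
  also have "\<dots> \<le> 4 * D"
    using distance_nonneg by simp
  finally have 1: "\<bar>(\<phi> 0)\<^sup>2 / q\<^sup>2 - (\<psi> 0)\<^sup>2 / q\<^sup>2\<bar> \<le> 4 * D / q\<^sup>2"
    by (simp add: power2_eq_square abs_divide divide_right_mono flip: diff_divide_distrib)
  have 2: "\<bar>(\<phi> 0)\<^sup>2 / q\<^sup>2\<bar> \<le> 4 / q\<^sup>2"
    using abs_le_square_iff[of "\<phi> 0" 2] near_cosD(3)[OF \<phi>, of 0] by (simp add: divide_right_mono)
  have 3: "\<bar>double_primitive g t\<bar> \<le> 98 * (2 * (q\<^sup>2 / 2400000))"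
    using g by (intro double_primitive_bound small_evenD)
  have 4: "\<bar>double_primitive f t - double_primitive g t\<bar> \<le> 98 * (q\<^sup>2 / 2400000 * D)"
    using f g diff by (intro double_primitive_diff_bound small_evenD)
  have "\<bar>forcing q \<phi> f t - forcing q \<psi> g t\<bar> \<le>
      4 / q\<^sup>2 * (98 * (q\<^sup>2 / 2400000 * D)) + 4 * D / q\<^sup>2 * (98 * (2 * (q\<^sup>2 / 2400000)))"
    unfolding forcing_def by (rule abs_mult_diff_le[OF 2 3 1 4])
  also have "\<dots> = 1176 / 2400000 * D"
    using q by (simp add: field_simps)
  also have "\<dots> \<le> D / 2000"
    using distance_nonneg by simp
  finally show ?thesis .
qed

lemma continuous_profiles: "continuous_on UNIV \<phi>" "continuous_on UNIV \<psi>"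
    "continuous_on UNIV (forcing q \<phi> f)" "continuous_on UNIV (forcing q \<psi> g)"
  using near_cosD(1)[OF \<phi>] near_cosD(1)[OF \<psi>]
    periodic_parity_forcing[OF small_evenD(1)[OF f]] periodic_parity_forcing[OF small_evenD(1)[OF g]]
  by (auto simp: periodic_parity_def)

lemma numerator_bound: "\<bar>primitive (\<lambda>t. cos t * forcing q \<phi> f t) (2 * pi)\<bar> \<le> 7 * (1/2000)"
  by (intro period_integral_bound abs_mult_le_right abs_cos_le_one forcing_bound q \<phi> f continuous_intros continuous_profiles)

lemma shift_bound: "\<bar>shift q \<phi> f\<bar> \<le> 5/2000"
proof -
  have "\<bar>shift q \<phi> f\<bar> = \<bar>primitive (\<lambda>t. cos t * forcing q \<phi> f t) (2 * pi)\<bar>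
      / primitive (\<lambda>t. cos t * \<phi> t) (2 * pi)"
    using primitive_cos_lower[OF \<phi>] by (simp add: shift_def abs_divide)
  also have "\<dots> \<le> 7 * (1/2000) / (3/2)"
    using primitive_cos_lower[OF \<phi>] numerator_bound by (intro frac_le) auto
  finally show ?thesis by simp
qed

text \<open>The quotient is treated as a product with a reciprocal. As both denominators are at
  least 3/2, the reciprocals differ by at most 28/9 * D, which is rounded up to 32/10 * D.\<close>

lemma shift_diff: "\<bar>shift q \<phi> f - shift q \<psi> g\<bar> \<le> 28/2000 * D"
proof -
  define N1 N2 d1 d2 where
    "N1 = primitive (\<lambda>t. cos t * forcing q \<phi> f t) (2 * pi)" and
    "N2 = primitive (\<lambda>t. cos t * forcing q \<psi> g t) (2 * pi)" and
    "d1 = primitive (\<lambda>t. cos t * \<phi> t) (2 * pi)" and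
    "d2 = primitive (\<lambda>t. cos t * \<psi> t) (2 * pi)"
  have d: "d1 \<ge> 3/2" "d2 \<ge> 3/2"
    using primitive_cos_lower \<phi> \<psi> by (auto simp: d1_def d2_def)
  have "\<bar>cos t * forcing q \<phi> f t - cos t * forcing q \<psi> g t\<bar> \<le> D / 2000" for t
    using abs_mult_le_right[OF abs_cos_le_one forcing_diff] by (simp add: right_diff_distrib)
  then have N: "\<bar>N1 - N2\<bar> \<le> 7 * (D / 2000)"
    unfolding N1_def N2_def by (intro period_integral_diff_bound continuous_intros continuous_profiles)
  have "\<bar>cos t * \<phi> t - cos t * \<psi> t\<bar> \<le> D" for t
    using abs_mult_le_right[OF abs_cos_le_one diff(1)] by (simp add: right_diff_distrib)
  then have dd: "\<bar>d1 - d2\<bar> \<le> 7 * D"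
    unfolding d1_def d2_def by (intro period_integral_diff_bound continuous_intros continuous_profiles)
  have "\<bar>1 / d1 - 1 / d2\<bar> = \<bar>d1 - d2\<bar> / (d1 * d2)"
    using d by (simp add: field_simps abs_divide abs_mult)
  also have "\<dots> \<le> 7 * D / (3/2 * (3/2))"
    using d dd distance_nonneg by (intro frac_le mult_mono) auto
  also have "\<dots> \<le> 32/10 * D"
    using distance_nonneg by simp
  finally have inv: "\<bar>1 / d1 - 1 / d2\<bar> \<le> 32/10 * D" .
  have "\<bar>1 / d2\<bar> \<le> 2/3"
    using d by (simp add: field_simps)
  then have "\<bar>N1 * (1 / d1) - N2 * (1 / d2)\<bar> \<le> 7 * (1/2000) * (32/10 * D) + 7 * (D / 2000) * (2/3)"
    using numerator_bound N inv by (intro abs_mult_diff_le) (auto simp: N1_def)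
  also have "\<dots> \<le> 28/2000 * D"
    using distance_nonneg by simp
  finally show ?thesis
    by (simp add: shift_def N1_def N2_def d1_def d2_def abs_minus_commute)
qed

lemma source_bound: "\<bar>source q \<phi> f t\<bar> \<le> 8/2000"
proof -
  have "\<bar>shift q \<phi> f * \<phi> t\<bar> \<le> 5/2000 * (5/4)"
    unfolding abs_mult by (intro mult_mono shift_bound near_cosD \<phi>) auto
  then show ?thesis
    using forcing_bound[OF q \<phi> f, of t] unfolding source_def by linarith
qed

lemma source_diff: "\<bar>source q \<phi> f t - source q \<psi> g t\<bar> \<le> 41/2000 * D"
proof -
  have "\<bar>shift q \<phi> f * \<phi> t - shift q \<psi> g * \<psi> t\<bar> \<le> 5/2000 * D + 28/2000 * D * (5/4)"
    by (intro abs_mult_diff_le shift_bound shift_diff diff near_cosD \<psi>)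
  then have "\<bar>(shift q \<phi> f * \<phi> t - shift q \<psi> g * \<psi> t) + (forcing q \<phi> f t - forcing q \<psi> g t)\<bar>
      \<le> (5/2000 * D + 28/2000 * D * (5/4)) + D / 2000"
    using forcing_diff[of t] by (intro order_trans[OF abs_triangle_ineq] add_mono)
  then show ?thesis
    by (simp add: source_def algebra_simps)
qed

text \<open>The three terms contribute at most 5/2000, 56/2000 and 56/2000, far below 1/4. This
  yields the invariance of \<open>near_cos\<close> under the map.\<close>

lemma reduced_map_near_cos: "\<bar>reduced_map q \<phi> f s - cos s\<bar> \<le> 1/4"
proof -
  note par = small_evenD(1)[OF f]
  have 1: "\<bar>primitive (\<lambda>t. cos t * source q \<phi> f t) s\<bar> \<le> 7 * (8/2000)"
    by (intro periodic_primitive_bound[where \<sigma> = 1] source_cos_sin(1) source_orthogonal_cos \<phi> par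
        abs_mult_le_right abs_cos_le_one source_bound)
  have 2: "\<bar>primitive (\<lambda>t. sin t * source q \<phi> f t) s\<bar> \<le> 7 * (8/2000)"
    by (intro periodic_primitive_bound[where \<sigma> = "-1"] source_cos_sin(2) source_cos_sin(3) \<phi> par
        abs_mult_le_right abs_sin_le_one source_bound)
  have "\<bar>cos s * shift q \<phi> f\<bar> \<le> 5/2000"
    by (intro abs_mult_le_right abs_cos_le_one shift_bound)
  moreover note abs_mult_le_right[OF abs_sin_le_one[of s] 1] abs_mult_le_right[OF abs_cos_le_one[of s] 2]
  moreover have "reduced_map q \<phi> f s - cos s = cos s * shift q \<phi> f
      - sin s * primitive (\<lambda>t. cos t * source q \<phi> f t) s
      + cos s * primitive (\<lambda>t. sin t * source q \<phi> f t) s"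
    by (simp add: reduced_map_def algebra_simps)
  ultimately show ?thesis by linarith
qed

text \<open>The three terms contribute 28/2000, 287/2000 and 287/2000 times \<open>D\<close>, in
  total 602/2000 and thus less than 1/2.\<close>

lemma reduced_map_diff: "\<bar>reduced_map q \<phi> f s - reduced_map q \<psi> g s\<bar> \<le> D / 2"
proof -
  note par = small_evenD(1)[OF f] small_evenD(1)[OF g]
  have "\<bar>cos t * source q \<phi> f t - cos t * source q \<psi> g t\<bar> \<le> 41/2000 * D" for t
    using abs_mult_le_right[OF abs_cos_le_one source_diff] by (simp add: right_diff_distrib)
  then have 1: "\<bar>primitive (\<lambda>t. cos t * source q \<phi> f t) s - primitive (\<lambda>t. cos t * source q \<psi> g t) s\<bar>
      \<le> 7 * (41/2000 * D)"
    by (intro periodic_primitive_diff_bound[where \<sigma> = 1 and \<tau> = 1] source_cos_sin(1)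
        source_orthogonal_cos \<phi> \<psi> par)
  have "\<bar>sin t * source q \<phi> f t - sin t * source q \<psi> g t\<bar> \<le> 41/2000 * D" for t
    using abs_mult_le_right[OF abs_sin_le_one source_diff] by (simp add: right_diff_distrib)
  then have 2: "\<bar>primitive (\<lambda>t. sin t * source q \<phi> f t) s - primitive (\<lambda>t. sin t * source q \<psi> g t) s\<bar>
      \<le> 7 * (41/2000 * D)"
    by (intro periodic_primitive_diff_bound[where \<sigma> = "-1" and \<tau> = "-1"] source_cos_sin(2)
        source_cos_sin(3) \<phi> \<psi> par)
  have "\<bar>cos s * (shift q \<phi> f - shift q \<psi> g)\<bar> \<le> 28/2000 * D"
    by (intro abs_mult_le_right abs_cos_le_one shift_diff)
  moreover note abs_mult_le_right[OF abs_sin_le_one[of s] 1] abs_mult_le_right[OF abs_cos_le_one[of s] 2]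
  moreover have "reduced_map q \<phi> f s - reduced_map q \<psi> g s = cos s * (shift q \<phi> f - shift q \<psi> g)
      - sin s * (primitive (\<lambda>t. cos t * source q \<phi> f t) s - primitive (\<lambda>t. cos t * source q \<psi> g t) s)
      + cos s * (primitive (\<lambda>t. sin t * source q \<phi> f t) s - primitive (\<lambda>t. sin t * source q \<psi> g t) s)"
    by (simp add: reduced_map_def algebra_simps)
  ultimately show ?thesis
    using distance_nonneg by linarith
qed

end

section \<open>Fixed points of the reduced map and their stability\<close>

definition small_lipschitz :: "real \<Rightarrow> (real \<Rightarrow> real) \<Rightarrow> bool" where
  "small_lipschitz q f \<longleftrightarrow> continuous_on UNIV f \<and> f 0 = 0 \<and>
     (\<forall>y z. \<bar>y\<bar> \<le> 2 \<longrightarrow> \<bar>z\<bar> \<le> 2 \<longrightarrow> \<bar>f y - f z\<bar> \<le> q\<^sup>2 / 2400000 * \<bar>y - z\<bar>)"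

definition profile :: "real \<Rightarrow> (real \<Rightarrow> real) \<Rightarrow> (real \<Rightarrow> real) \<Rightarrow> bool" where
  "profile q f \<phi> \<longleftrightarrow> near_cos \<phi> \<and> reduced_map q \<phi> (\<lambda>x. f (\<phi> x)) = \<phi>"

text \<open>Comparison with \<open>f 0 = 0\<close> turns the Lipschitz bound into a bound on values.
  The radius 2 covers the range of every \<open>near_cos\<close> function, which is bounded by
  5/4.\<close>

lemma small_even_comp:
  assumes f: "small_lipschitz q f" and \<phi>: "near_cos \<phi>"
  shows "small_even q (\<lambda>x. f (\<phi> x))"
proof -
  have "\<bar>f (\<phi> x)\<bar> \<le> 2 * (q\<^sup>2 / 2400000)" for x
  proof -
    have "\<bar>f (\<phi> x) - f 0\<bar> \<le> q\<^sup>2 / 2400000 * \<bar>\<phi> x - 0\<bar>"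
      using f near_cosD(3)[OF \<phi>, of x] unfolding small_lipschitz_def
      by (elim conjE allE[of _ "\<phi> x"] allE[of _ 0]) simp
    also have "\<dots> \<le> q\<^sup>2 / 2400000 * 2"
      using near_cosD(3)[OF \<phi>, of x] by (intro mult_left_mono) auto
    finally show ?thesis
      using f by (simp add: small_lipschitz_def)
  qed
  then show ?thesis
    using f near_cosD(1)[OF \<phi>] by (auto simp: small_even_def small_lipschitz_def intro: periodic_parity_comp)
qed

lemma near_cos_bcontfun:
  assumes "near_cos \<phi>"
  shows "\<phi> \<in> bcontfun"
  using near_cosD(1,3)[OF assms]
  by (auto simp: bcontfun_def bounded_iff periodic_parity_def intro!: exI[of _ "5/4"])

text \<open>Point evaluations are continuous in the uniform metric, so conditions imposed pointwise
  cut out a closed subset of a complete space.\<close>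

lemma complete_near_cos: "complete {\<phi> :: real \<Rightarrow>\<^sub>C real. near_cos (apply_bcontfun \<phi>)}"
proof -
  have "isCont (\<lambda>\<phi> :: real \<Rightarrow>\<^sub>C real. apply_bcontfun \<phi> x) \<psi>" for x \<psi>
    unfolding isCont_def
    by (rule tendsto_uniform_limitI[OF tendsto_bcontfun_uniform_limit]) (auto intro: tendsto_ident_at)
  then have [continuous_intros]: "continuous_on UNIV (\<lambda>\<phi> :: real \<Rightarrow>\<^sub>C real. apply_bcontfun \<phi> x)" for x
    by (simp add: continuous_at_imp_continuous_on)
  have "closed {\<phi> :: real \<Rightarrow>\<^sub>C real. near_cos (apply_bcontfun \<phi>)}"
    unfolding near_cos_def periodic_parity_def
    by (intro closed_Collect_conj closed_Collect_all closed_Collect_eq closed_Collect_le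
        closed_Collect_const continuous_intros) auto
  then show ?thesis
    by (simp add: complete_eq_closed)
qed

lemma profile_exists:
  assumes q: "q > 0" and f: "small_lipschitz q f"
  shows "\<exists>\<phi> :: real \<Rightarrow> real. profile q f \<phi>"
proof -
  define S where "S = {\<phi> :: real \<Rightarrow>\<^sub>C real. near_cos (apply_bcontfun \<phi>)}"
  define T :: "(real \<Rightarrow>\<^sub>C real) \<Rightarrow> (real \<Rightarrow>\<^sub>C real)" where
    "T \<phi> = Bcontfun (reduced_map q \<phi> (\<lambda>x. f (\<phi> x)))" for \<phi>
  have near: "near_cos (reduced_map q \<phi> (\<lambda>x. f (\<phi> x)))" if \<phi>: "near_cos \<phi>" for \<phi>
  proof -
    note p = small_even_comp[OF f \<phi>]
    \<comment> \<open>The bound concerns a single profile, so both profiles of the context are taken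
      equal, at distance 0.\<close>
    show ?thesis
      unfolding near_cos_def
      using periodic_parity_reduced_map[OF \<phi> small_evenD(1)[OF p]]
        reduced_map_near_cos[OF q \<phi> \<phi> p p, of 0] by auto
  qed
  have T: "apply_bcontfun (T \<phi>) = reduced_map q \<phi> (\<lambda>x. f (\<phi> x))" if "\<phi> \<in> S" for \<phi>
    unfolding T_def using that by (intro Bcontfun_inverse near_cos_bcontfun near) (simp add: S_def)
  have "\<exists>!\<phi>\<in>S. T \<phi> = \<phi>"
  proof (rule Banach_fix[where c = "1/2"])
    show "complete S"
      unfolding S_def by (rule complete_near_cos)
    have "near_cos cos"
      by (simp add: near_cos_def periodic_parity_cos)
    then have "Bcontfun cos \<in> S"
      using Bcontfun_inverse[OF near_cos_bcontfun] by (simp add: S_def)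
    then show "S \<noteq> {}" by blast
    show "T ` S \<subseteq> S"
      using T near by (auto simp: S_def)
    show "dist (T \<phi>) (T \<psi>) \<le> 1/2 * dist \<phi> \<psi>" if "\<phi> \<in> S" "\<psi> \<in> S" for \<phi> \<psi>
    proof (rule dist_bound)
      fix x
      have \<phi>: "near_cos \<phi>" and \<psi>: "near_cos \<psi>"
        using that by (auto simp: S_def)
      have d: "\<bar>\<phi> t - \<psi> t\<bar> \<le> dist \<phi> \<psi>" for t
        using dist_bounded[of \<phi> t \<psi>] by (simp add: dist_real_def)
      have d': "\<bar>f (\<phi> t) - f (\<psi> t)\<bar> \<le> q\<^sup>2 / 2400000 * dist \<phi> \<psi>" for t
      proof -
        have "\<bar>f (\<phi> t) - f (\<psi> t)\<bar> \<le> q\<^sup>2 / 2400000 * \<bar>\<phi> t - \<psi> t\<bar>"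
          using f near_cosD(3)[OF \<phi>, of t] near_cosD(3)[OF \<psi>, of t] by (simp add: small_lipschitz_def)
        also have "\<dots> \<le> q\<^sup>2 / 2400000 * dist \<phi> \<psi>"
          using d by (intro mult_left_mono) auto
        finally show ?thesis .
      qed
      show "dist (T \<phi> x) (T \<psi> x) \<le> 1/2 * dist \<phi> \<psi>"
        using reduced_map_diff[OF q \<phi> \<psi> small_even_comp[OF f \<phi>] small_even_comp[OF f \<psi>] d d', of x] that
        by (simp add: T dist_real_def)
    qed
  qed auto
  then obtain \<phi> where "\<phi> \<in> S" "T \<phi> = \<phi>" by blast
  then have "profile q f (apply_bcontfun \<phi>)"
    using T[of \<phi>] by (simp add: profile_def S_def)
  then show ?thesis by blast
qed

text \<open>Profiles are obtained without any explicit dependence on the nonlinearity. This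
  stability estimate supplies the continuity needed for the intermediate value argument, and it
  holds for every choice of profiles.\<close>

lemma profile_average_diff:
  assumes q: "q > 0" and f: "small_lipschitz q f" and g: "small_lipschitz q g"
    and \<phi>: "profile q f \<phi>" and \<psi>: "profile q g \<psi>"
    and le: "\<And>y. \<bar>y\<bar> \<le> 2 \<Longrightarrow> \<bar>f y - g y\<bar> \<le> q\<^sup>2 / 2400000 * c"
  shows "\<bar>average (\<lambda>x. f (\<phi> x)) - average (\<lambda>x. g (\<psi> x))\<bar> \<le> q\<^sup>2 / 2400000 * (2 * c)"
proof -
  have n: "near_cos \<phi>" "near_cos \<psi>"
    using \<phi> \<psi> by (auto simp: profile_def)
  define D where "D = dist (Bcontfun \<phi>) (Bcontfun \<psi>)"
  note [simp] = n[THEN near_cos_bcontfun, THEN Bcontfun_inverse]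
  have c: "c \<ge> 0"
    using order_trans[OF abs_ge_zero le[of 0]] q by (simp add: zero_le_mult_iff)
  have d: "\<bar>\<phi> t - \<psi> t\<bar> \<le> D" for t
    using dist_bounded[of "Bcontfun \<phi>" t "Bcontfun \<psi>"] by (simp add: dist_real_def D_def)
  have d': "\<bar>f (\<phi> t) - g (\<psi> t)\<bar> \<le> q\<^sup>2 / 2400000 * (D + c)" for t
  proof -
    have "\<bar>f (\<phi> t) - f (\<psi> t)\<bar> \<le> q\<^sup>2 / 2400000 * \<bar>\<phi> t - \<psi> t\<bar>"
      using f near_cosD(3)[OF n(1), of t] near_cosD(3)[OF n(2), of t] by (simp add: small_lipschitz_def)
    also have "\<dots> \<le> q\<^sup>2 / 2400000 * D"
      using d by (intro mult_left_mono) auto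
    finally have "\<bar>f (\<phi> t) - f (\<psi> t)\<bar> \<le> q\<^sup>2 / 2400000 * D" .
    moreover have "\<bar>f (\<psi> t) - g (\<psi> t)\<bar> \<le> q\<^sup>2 / 2400000 * c"
      using near_cosD(3)[OF n(2), of t] by (intro le) simp
    ultimately show ?thesis
      unfolding distrib_left by linarith
  qed
  \<comment> \<open>Both profiles are fixed points, so the contraction estimate at distance
    \<open>D + c\<close> bounds their own distance; solving \<open>D \<le> (D + c) / 2\<close> gives
    \<open>D \<le> c\<close>.\<close>
  have "\<bar>\<phi> t - \<psi> t\<bar> \<le> (D + c) / 2" for t
    using reduced_map_diff[OF q n(1) n(2) small_even_comp[OF f n(1)] small_even_comp[OF g n(2)] _ d', of t]
      d c \<phi> \<psi> by (simp add: profile_def add_increasing2)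
  then have "D \<le> (D + c) / 2"
    unfolding D_def by (intro dist_bound) (simp add: dist_real_def)
  then have "D \<le> c" by simp
  have "\<bar>average (\<lambda>x. f (\<phi> x)) - average (\<lambda>x. g (\<psi> x))\<bar> \<le> q\<^sup>2 / 2400000 * (D + c)"
    using small_evenD(1)[OF small_even_comp[OF f n(1)]] small_evenD(1)[OF small_even_comp[OF g n(2)]] d'
    by (intro average_diff_bound) (auto simp: periodic_parity_def)
  also have "\<dots> \<le> q\<^sup>2 / 2400000 * (2 * c)"
    using \<open>D \<le> c\<close> by (intro mult_left_mono) auto
  finally show ?thesis .
qed

section \<open>Regularity of profiles and the fourth-order equation\<close>

lemma profile_derivatives:
  assumes f: "small_lipschitz q f" and \<phi>: "profile q f \<phi>"
  obtains \<phi>\<^sub>1 \<phi>\<^sub>2 \<phi>\<^sub>3 where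
    "\<And>x. (\<phi> has_real_derivative \<phi>\<^sub>1 x) (at x)"
    "\<And>x. (\<phi>\<^sub>1 has_real_derivative \<phi>\<^sub>2 x) (at x)"
    "\<And>x. (\<phi>\<^sub>2 has_real_derivative \<phi>\<^sub>3 x) (at x)"
    "\<And>x. (\<phi>\<^sub>3 has_real_derivative
        - (\<phi> 0 * \<phi>\<^sub>2 x) - (\<phi> 0)\<^sup>2 / q\<^sup>2 * (f (\<phi> x) - average (\<lambda>x. f (\<phi> x)))) (at x)"
proof -
  define p where "p x = f (\<phi> x)" for x
  have n: "near_cos \<phi>" and fixed: "\<phi> = reduced_map q \<phi> p"
    using \<phi> unfolding profile_def p_def[abs_def] by auto
  have par: "periodic_parity 1 p"
    unfolding p_def using small_evenD(1)[OF small_even_comp[OF f n]] .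
  define \<beta> g P Q G\<^sub>1 where "\<beta> = shift q \<phi> p" and "g = source q \<phi> p"
    and "P = primitive (\<lambda>t. cos t * source q \<phi> p t)"
    and "Q = primitive (\<lambda>t. sin t * source q \<phi> p t)"
    and "G\<^sub>1 = primitive (\<lambda>t. p t - average p)"
  \<comment> \<open>Both primitives vanish at 0. Hence the normalisation \<open>b = \<phi> 0\<close>
    is consistent with reading \<open>shift\<close> as \<open>b - 1\<close>.\<close>
  have 0: "\<phi> 0 = 1 + \<beta>"
    by (subst fixed) (simp add: reduced_map_def \<beta>_def)
  have P: "(P has_real_derivative cos x * g x) (at x)" and Q: "(Q has_real_derivative sin x * g x) (at x)" for x
    unfolding P_def Q_def g_def
    by (rule has_real_derivative_primitive;
        use source_cos_sin[OF n par, of q] in \<open>auto simp: periodic_parity_def\<close>)+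
  have G: "(double_primitive p has_real_derivative G\<^sub>1 x) (at x)"
    "(G\<^sub>1 has_real_derivative p x - average p) (at x)" for x
    unfolding double_primitive_def G\<^sub>1_def
    by (rule has_real_derivative_primitive;
        use periodic_parity_sub_average[OF par] in \<open>auto simp: periodic_parity_def\<close>)+
  have eq: "\<phi> = (\<lambda>s. (1 + \<beta>) * cos s - sin s * P s + cos s * Q s)"
    by (subst fixed) (simp add: fun_eq_iff reduced_map_def \<beta>_def P_def Q_def)
  \<comment> \<open>The second derivative is defined by the twice integrated equation. Two more
    derivatives then only undo the two integrations in \<open>double_primitive\<close>.\<close>
  define \<phi>\<^sub>1 \<phi>\<^sub>2 \<phi>\<^sub>3 where
    "\<phi>\<^sub>1 s = - (1 + \<beta>) * sin s - cos s * P s - sin s * Q s" and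
    "\<phi>\<^sub>2 s = - (\<phi> 0 * \<phi> s) - (\<phi> 0)\<^sup>2 / q\<^sup>2 * double_primitive p s" and
    "\<phi>\<^sub>3 s = - (\<phi> 0 * \<phi>\<^sub>1 s) - (\<phi> 0)\<^sup>2 / q\<^sup>2 * G\<^sub>1 s" for s
  have d1: "(\<phi> has_real_derivative \<phi>\<^sub>1 x) (at x)" for x
    unfolding \<phi>\<^sub>1_def
    by (subst eq) (auto intro!: derivative_eq_intros P Q simp: algebra_simps)
  have "\<phi>\<^sub>2 x = - \<phi> x - g x" for x
    by (simp add: \<phi>\<^sub>2_def g_def source_def forcing_def 0 flip: \<beta>_def) (simp add: algebra_simps)
  \<comment> \<open>Differentiating the first derivative produces the two terms
    \<open>g x * (sin x)\<^sup>2\<close> and \<open>g x * (cos x)\<^sup>2\<close>; their sum is left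
    unsimplified here to match.\<close>
  moreover have "- \<phi> x - g x = - (1 + \<beta>) * cos x + sin x * P x - cos x * Q x
      - g x * ((sin x)\<^sup>2 + (cos x)\<^sup>2)" for x
    by (subst eq) (simp add: algebra_simps)
  ultimately have \<phi>\<^sub>2: "\<phi>\<^sub>2 x = - (1 + \<beta>) * cos x + sin x * P x - cos x * Q x
      - g x * ((sin x)\<^sup>2 + (cos x)\<^sup>2)" for x
    by metis
  have d2: "(\<phi>\<^sub>1 has_real_derivative \<phi>\<^sub>2 x) (at x)" for x
    unfolding \<phi>\<^sub>1_def \<phi>\<^sub>2
    by (rule derivative_eq_intros P Q refl)+ (simp add: algebra_simps power2_eq_square
        del: sin_cos_squared_add sin_cos_squared_add2 sin_cos_squared_add3)
  have d3: "(\<phi>\<^sub>2 has_real_derivative \<phi>\<^sub>3 x) (at x)" for x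
    unfolding \<phi>\<^sub>2_def \<phi>\<^sub>3_def by (intro DERIV_diff DERIV_minus DERIV_cmult d1 G)
  have d4: "(\<phi>\<^sub>3 has_real_derivative - (\<phi> 0 * \<phi>\<^sub>2 x) - (\<phi> 0)\<^sup>2 / q\<^sup>2 * (p x - average p)) (at x)" for x
    unfolding \<phi>\<^sub>3_def by (intro DERIV_diff DERIV_minus DERIV_cmult d2 G)
  show thesis
    using that[OF d1 d2 d3] d4 by (simp add: p_def[abs_def])
qed

section \<open>Small periodic solutions\<close>

text \<open>Division by \<open>r\<close> compensates the scaling of the argument, so the Lipschitz
  constant of \<open>d\<close> near \<open>a\<close> is inherited whatever the size of
  \<open>r\<close>.\<close>

definition increment :: "(real \<Rightarrow> real) \<Rightarrow> real \<Rightarrow> real \<Rightarrow> real \<Rightarrow> real" where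
  "increment d r a y = (d (a + r * y) - d a) / r"

lemma bifurcation:
  fixes d :: "real \<Rightarrow> real"
  assumes q: "q > 0" and \<eta>: "\<eta> > 0" and cont: "continuous_on UNIV d"
    and lip: "\<And>x y. \<bar>x\<bar> \<le> \<eta> \<Longrightarrow> \<bar>y\<bar> \<le> \<eta> \<Longrightarrow> \<bar>d x - d y\<bar> \<le> q\<^sup>2 / 2400000 * \<bar>x - y\<bar>"
    and a: "- (\<eta> / 2) \<le> a\<^sub>1" "a\<^sub>1 \<le> a\<^sub>2" "a\<^sub>2 \<le> \<eta> / 2" "d a\<^sub>1 < 0" "d a\<^sub>2 > 0"
  obtains a r \<phi> where "\<bar>a\<bar> \<le> \<eta> / 2" "0 < r" "r \<le> \<eta> / 4"
    "small_lipschitz q (increment d r a)" "profile q (increment d r a) \<phi>"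
    "d a + r * average (\<lambda>x. increment d r a (\<phi> x)) = 0"
proof -
  define e where "e = q\<^sup>2 / 2400000"
  have e: "e > 0"
    using q by (simp add: e_def)
  \<comment> \<open>The bound \<eta>/4 keeps \<open>a + r * y\<close> within [-\<eta>, \<eta>] for
    \<bar>y\<bar> \<le> 2. The other bound makes the correction \<open>r * average\<close>, of size
    at most \<open>r * (2 * e)\<close>, too small to change the signs of \<open>d\<close> at the two
    endpoints.\<close>
  define r where "r = min (\<eta> / 4) (min (- d a\<^sub>1) (d a\<^sub>2) / (2 * e))"
  have r: "0 < r" "r \<le> \<eta> / 4"
    using \<eta> e a by (auto simp: r_def)
  have "r \<le> min (- d a\<^sub>1) (d a\<^sub>2) / (2 * e)"
    by (simp add: r_def)
  then have "r * (2 * e) \<le> min (- d a\<^sub>1) (d a\<^sub>2)"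
    using e by (simp add: pos_le_divide_eq)
  then have small: "r * (2 * e) \<le> - d a\<^sub>1" "r * (2 * e) \<le> d a\<^sub>2"
    by auto
  have in_range: "\<bar>a + r * y\<bar> \<le> \<eta>" if "\<bar>a\<bar> \<le> \<eta> / 2" "\<bar>y\<bar> \<le> 2" for a y
  proof -
    have "\<bar>r * y\<bar> \<le> \<eta> / 4 * 2"
      unfolding abs_mult using that r by (intro mult_mono) auto
    with that show ?thesis by linarith
  qed
  have sl: "small_lipschitz q (increment d r a)" if a: "\<bar>a\<bar> \<le> \<eta> / 2" for a
  proof -
    have "\<bar>increment d r a y - increment d r a z\<bar> \<le> e * \<bar>y - z\<bar>" if "\<bar>y\<bar> \<le> 2" "\<bar>z\<bar> \<le> 2" for y z
    proof -
      have "\<bar>d (a + r * y) - d (a + r * z)\<bar> \<le> e * \<bar>(a + r * y) - (a + r * z)\<bar>"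
        unfolding e_def using a that by (intro lip in_range)
      also have "\<bar>(a + r * y) - (a + r * z)\<bar> = r * \<bar>y - z\<bar>"
        using r by (simp add: abs_mult flip: right_diff_distrib)
      finally show ?thesis
        using r by (simp add: increment_def abs_divide divide_le_eq mult_ac flip: diff_divide_distrib)
    qed
    moreover have "continuous_on UNIV (increment d r a)"
      unfolding increment_def using r
      by (intro continuous_intros continuous_on_compose2[OF cont]) auto
    ultimately show ?thesis
      by (simp add: small_lipschitz_def e_def increment_def[of _ _ _ 0])
  qed
  \<comment> \<open>An arbitrary choice of profiles is harmless: the continuity of \<open>m\<close>
    below comes from the stability estimate and not from the choice.\<close>
  define \<Phi> where "\<Phi> a = (SOME \<phi>. profile q (increment d r a) \<phi>)" for a
  have \<Phi>: "profile q (increment d r a) (\<Phi> a)" if "\<bar>a\<bar> \<le> \<eta> / 2" for a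
    unfolding \<Phi>_def by (rule someI_ex[OF profile_exists[OF q sl[OF that]]])
  define m where "m a = average (\<lambda>x. increment d r a (\<Phi> a x))" for a
  have m: "\<bar>m a\<bar> \<le> 2 * e" if a: "\<bar>a\<bar> \<le> \<eta> / 2" for a
  proof -
    have "small_even q (\<lambda>x. increment d r a (\<Phi> a x))"
      using \<Phi>[OF a] by (intro small_even_comp sl a) (simp add: profile_def)
    then show ?thesis
      unfolding m_def e_def by (intro average_bound) (auto simp: small_even_def periodic_parity_def)
  qed
  have "\<bar>m x - m y\<bar> \<le> 4 * e / r * \<bar>x - y\<bar>" if x: "\<bar>x\<bar> \<le> \<eta> / 2" and y: "\<bar>y\<bar> \<le> \<eta> / 2" for x y
  proof -
    have "\<bar>increment d r x z - increment d r y z\<bar> \<le> e * (2 * \<bar>x - y\<bar> / r)" if z: "\<bar>z\<bar> \<le> 2" for z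
    proof -
      have "\<bar>d (x + r * z) - d (y + r * z)\<bar> \<le> e * \<bar>(x + r * z) - (y + r * z)\<bar>"
        unfolding e_def using x y z by (intro lip in_range)
      moreover have "\<bar>d x - d y\<bar> \<le> e * \<bar>x - y\<bar>"
        unfolding e_def using x y \<eta> by (intro lip) auto
      ultimately have "\<bar>(d (x + r * z) - d x) - (d (y + r * z) - d y)\<bar> \<le> e * (2 * \<bar>x - y\<bar>)"
        by simp
      then show ?thesis
        using r by (simp add: increment_def abs_divide divide_right_mono flip: diff_divide_distrib)
    qed
    then have "\<bar>m x - m y\<bar> \<le> e * (2 * (2 * \<bar>x - y\<bar> / r))"
      unfolding m_def e_def by (intro profile_average_diff q sl \<Phi> x y)
    then show ?thesis by (simp add: mult_ac)
  qed
  then have "(4 * e / r)-lipschitz_on {a\<^sub>1..a\<^sub>2} m"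
    using e r a by (intro lipschitz_onI) (auto simp: dist_real_def)
  then have "continuous_on {a\<^sub>1..a\<^sub>2} m"
    by (rule lipschitz_on_continuous_on)
  moreover have "continuous_on {a\<^sub>1..a\<^sub>2} d"
    using cont by (rule continuous_on_subset) simp
  ultimately have "continuous_on {a\<^sub>1..a\<^sub>2} (\<lambda>a. d a + r * m a)"
    by (intro continuous_intros)
  moreover have "\<bar>r * m a\<^sub>1\<bar> \<le> r * (2 * e)" "\<bar>r * m a\<^sub>2\<bar> \<le> r * (2 * e)"
    unfolding abs_mult using r a m by (auto intro!: mult_mono)
  then have "d a\<^sub>1 + r * m a\<^sub>1 \<le> 0" "0 \<le> d a\<^sub>2 + r * m a\<^sub>2"
    using small by linarith+
  ultimately obtain a where "a\<^sub>1 \<le> a" "a \<le> a\<^sub>2" "d a + r * m a = 0"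
    using IVT'[of "\<lambda>a. d a + r * m a" a\<^sub>1 0 a\<^sub>2] a by blast
  then show thesis
    using a r sl \<Phi> by (intro that[of a r "\<Phi> a"]) (auto simp: m_def)
qed

section \<open>From profiles to solutions of the differential equation\<close>

lemma C_4_of_derivatives:
  assumes "\<And>x. (u has_real_derivative u\<^sub>1 x) (at x)" and "\<And>x. (u\<^sub>1 has_real_derivative u\<^sub>2 x) (at x)"
    and "\<And>x. (u\<^sub>2 has_real_derivative u\<^sub>3 x) (at x)" and "\<And>x. (u\<^sub>3 has_real_derivative u\<^sub>4 x) (at x)"
    and "continuous_on UNIV u\<^sub>4"
  shows "C_k 4 u" and "(deriv ^^ 2) u = u\<^sub>2" and "(deriv ^^ 4) u = u\<^sub>4"
proof -
  have d: "deriv u = u\<^sub>1" "deriv u\<^sub>1 = u\<^sub>2" "deriv u\<^sub>2 = u\<^sub>3" "deriv u\<^sub>3 = u\<^sub>4"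
    using assms by (auto intro!: ext DERIV_imp_deriv)
  then show "(deriv ^^ 2) u = u\<^sub>2" "(deriv ^^ 4) u = u\<^sub>4"
    by (simp_all add: numeral_eq_Suc)
  have "u differentiable_on UNIV" "u\<^sub>1 differentiable_on UNIV" "u\<^sub>2 differentiable_on UNIV" "u\<^sub>3 differentiable_on UNIV"
    using assms unfolding differentiable_on_def
    by (meson differentiable_at_withinI real_differentiable_def)+
  then show "C_k 4 u"
    using d assms(5) by (auto simp: C_k_def numeral_eq_Suc less_Suc_eq)
qed

text \<open>With b = \<open>\<phi> 0\<close>, the frequency satisfies
  \<open>\<omega>\<^sup>2 = q / b\<close>, so \<open>\<omega>^4 * b = q * \<omega>\<^sup>2\<close>
  and \<open>\<omega>^4 * b\<^sup>2 / q\<^sup>2 = 1\<close>. The scaled profile equation thus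
  becomes \<open>u'''' + q * u'' + r * (p - average p) = 0\<close>, and \<open>balance\<close>
  identifies the last term with \<open>deriv F (u x)\<close>.\<close>

lemma solution_of_profile:
  assumes q: "q > 0" and r: "r > 0" and cont: "continuous_on UNIV (deriv F)"
    and f: "small_lipschitz q (increment (deriv F) r a)"
    and \<phi>: "profile q (increment (deriv F) r a) \<phi>"
    and balance: "deriv F a + r * average (\<lambda>x. increment (deriv F) r a (\<phi> x)) = 0"
  shows "is_solution F q (\<lambda>x. a + r * \<phi> (sqrt (q / \<phi> 0) * x))"
    and "nontrivial (\<lambda>x. a + r * \<phi> (sqrt (q / \<phi> 0) * x))"
    and "periodic (\<lambda>x. a + r * \<phi> (sqrt (q / \<phi> 0) * x))"
proof -
  have n: "near_cos \<phi>"
    using \<phi> by (simp add: profile_def)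
  define b where "b = \<phi> 0"
  have b: "b > 0"
    using near_cosD(2)[OF n, of 0] unfolding b_def cos_zero by linarith
  define \<omega> where "\<omega> = sqrt (q / \<phi> 0)"
  have \<omega>: "\<omega> > 0" "\<omega>\<^sup>2 = q / b"
    using q b by (auto simp: \<omega>_def b_def)
  define u where "u x = a + r * \<phi> (\<omega> * x)" for x
  define p where "p x = increment (deriv F) r a (\<phi> x)" for x
  obtain \<phi>\<^sub>1 \<phi>\<^sub>2 \<phi>\<^sub>3 where deriv_\<phi>:
    "\<And>x. (\<phi> has_real_derivative \<phi>\<^sub>1 x) (at x)" "\<And>x. (\<phi>\<^sub>1 has_real_derivative \<phi>\<^sub>2 x) (at x)"
    "\<And>x. (\<phi>\<^sub>2 has_real_derivative \<phi>\<^sub>3 x) (at x)"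
    "\<And>x. (\<phi>\<^sub>3 has_real_derivative - (b * \<phi>\<^sub>2 x) - b\<^sup>2 / q\<^sup>2 * (p x - average p)) (at x)"
    using profile_derivatives[OF f \<phi>] unfolding p_def[abs_def] b_def by metis
  have scaled: "((\<lambda>x. c * h (\<omega> * x)) has_real_derivative c * \<omega> * h' (\<omega> * x)) (at x)"
    if "\<And>y. (h has_real_derivative h' y) (at y)" for c h h' x
    by (rule derivative_eq_intros DERIV_chain2[OF that] refl)+ simp
  define u\<^sub>1 u\<^sub>2 u\<^sub>3 u\<^sub>4 where "u\<^sub>1 x = r * \<omega> * \<phi>\<^sub>1 (\<omega> * x)" and "u\<^sub>2 x = r * \<omega> * \<omega> * \<phi>\<^sub>2 (\<omega> * x)"
    and "u\<^sub>3 x = r * \<omega> * \<omega> * \<omega> * \<phi>\<^sub>3 (\<omega> * x)"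
    and "u\<^sub>4 x = r * \<omega> * \<omega> * \<omega> * \<omega> *
      (- (b * \<phi>\<^sub>2 (\<omega> * x)) - b\<^sup>2 / q\<^sup>2 * (p (\<omega> * x) - average p))" for x
  have "(u has_real_derivative u\<^sub>1 x) (at x)" for x
    using DERIV_add[OF DERIV_const[of a] scaled[OF deriv_\<phi>(1), of r x]]
    unfolding u_def[abs_def] u\<^sub>1_def by simp
  moreover have "(u\<^sub>1 has_real_derivative u\<^sub>2 x) (at x)" "(u\<^sub>2 has_real_derivative u\<^sub>3 x) (at x)"
    "(u\<^sub>3 has_real_derivative u\<^sub>4 x) (at x)" for x
    unfolding u\<^sub>1_def[abs_def] u\<^sub>2_def[abs_def] u\<^sub>3_def[abs_def] u\<^sub>4_def by (intro scaled deriv_\<phi>)+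
  moreover have "continuous_on UNIV u\<^sub>4"
  proof -
    have "continuous_on UNIV p"
      using small_evenD(1)[OF small_even_comp[OF f n]] by (simp add: p_def[abs_def] periodic_parity_def)
    moreover have "continuous_on UNIV \<phi>\<^sub>2"
      using deriv_\<phi>(3) by (meson DERIV_isCont continuous_at_imp_continuous_on)
    ultimately have "continuous_on UNIV (\<lambda>x. p (\<omega> * x))" "continuous_on UNIV (\<lambda>x. \<phi>\<^sub>2 (\<omega> * x))"
      by (auto intro!: continuous_intros elim!: continuous_on_compose2)
    then show ?thesis
      unfolding u\<^sub>4_def[abs_def] by (intro continuous_intros) (use q in auto)
  qed
  ultimately have C4: "C_k 4 u" "(deriv ^^ 2) u = u\<^sub>2" "(deriv ^^ 4) u = u\<^sub>4"
    by (rule C_4_of_derivatives)+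
  have "u\<^sub>4 x + q * u\<^sub>2 x + deriv F (u x) = 0" for x
  proof -
    have 1: "deriv F (u x) = deriv F a + r * p (\<omega> * x)"
      using r by (simp add: u_def p_def increment_def)
    have 2: "u\<^sub>2 x = r * (q / b) * \<phi>\<^sub>2 (\<omega> * x)"
      unfolding u\<^sub>2_def \<omega>(2)[symmetric] by (simp add: power2_eq_square)
    have 3: "u\<^sub>4 x = r * (q / b)\<^sup>2 * (- (b * \<phi>\<^sub>2 (\<omega> * x)) - b\<^sup>2 / q\<^sup>2 * (p (\<omega> * x) - average p))"
      unfolding u\<^sub>4_def \<omega>(2)[symmetric] by (simp add: power2_eq_square)
    have 4: "deriv F a = - (r * average p)"
      using balance unfolding p_def[abs_def] by linarith
    show ?thesis
      unfolding 1 2 3 4 using q b by (simp add: field_simps power2_eq_square)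
  qed
  then show "is_solution F q (\<lambda>x. a + r * \<phi> (sqrt (q / \<phi> 0) * x))"
    unfolding is_solution_def \<omega>_def[symmetric] u_def[symmetric] using C4 by simp
  \<comment> \<open>Being within 1/4 of \<open>cos\<close>, the profile is at least 3/4 at 0 and at
    most -3/4 at \<open>pi\<close>.\<close>
  have "\<phi> 0 \<noteq> \<phi> pi"
    using near_cosD(2)[OF n, of 0] near_cosD(2)[OF n, of pi] unfolding cos_zero cos_pi by linarith
  then have "u 0 \<noteq> u (pi / \<omega>)"
    using r \<omega>(1) by (simp add: u_def)
  then have "nontrivial u"
    unfolding nontrivial_def constant_on_def by (metis UNIV_I)
  then show "nontrivial (\<lambda>x. a + r * \<phi> (sqrt (q / \<phi> 0) * x))"
    by (simp add: u_def[abs_def] \<omega>_def)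
  have "u (x + 2 * pi / \<omega>) = u x" for x
    using \<omega>(1) periodic_parityD(3)[OF near_cosD(1)[OF n], of "\<omega> * x"] by (simp add: u_def distrib_left)
  then have "periodic u"
    unfolding periodic_def using \<omega>(1) by (intro exI[of _ "2 * pi / \<omega>"]) simp
  then show "periodic (\<lambda>x. a + r * \<phi> (sqrt (q / \<phi> 0) * x))"
    by (simp add: u_def[abs_def] \<omega>_def)
qed

section \<open>Solutions of amplitude at most \<open>q\<close> near the strict minimum\<close>

lemma small_solution_exists:
  fixes F :: "real \<Rightarrow> real"
  assumes C2: "C_k 2 F" and argmin: "Argmin F = {0}" and flat: "(deriv ^^ 2) F 0 = 0" and q: "q > 0"
  shows "\<exists>u. is_solution F q u \<and> nontrivial u \<and> periodic u \<and> 0 \<le> sup_norm u \<and> sup_norm u \<le> q"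
proof -
  define d where "d = deriv F"
  have "F differentiable_on UNIV" "d differentiable_on UNIV" and cont': "continuous_on UNIV (deriv d)"
    using C2 by (auto simp: C_k_def d_def numeral_2_eq_2 less_Suc_eq)
  then have F: "(F has_real_derivative d x) (at x)" and d: "(d has_real_derivative deriv d x) (at x)" for x
    unfolding d_def differentiable_on_def
    by (auto simp: DERIV_deriv_iff_real_differentiable)
  have cont: "continuous_on UNIV d"
    using d by (meson DERIV_isCont continuous_at_imp_continuous_on)
  have min: "F 0 < F x" if "x \<noteq> 0" for x
  proof -
    have "0 \<in> Argmin F" "x \<notin> Argmin F"
      using argmin that by auto
    then show ?thesis
      by (auto simp: Argmin_def is_arg_min_def not_less) (meson le_less_trans not_le)
  qed
  have "isCont (deriv d) 0" "deriv d 0 = 0"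
    using cont' flat by (auto simp: continuous_on_eq_continuous_at d_def numeral_2_eq_2)
  then obtain s where s: "s > 0" "\<And>x. \<bar>x\<bar> < s \<Longrightarrow> \<bar>deriv d x\<bar> < q\<^sup>2 / 2400000"
    using q unfolding continuous_at_eps_delta
    by (metis diff_zero dist_real_def divide_pos_pos zero_less_numeral zero_less_power)
  \<comment> \<open>Half of \<open>s\<close> puts the closed interval [-\<eta>, \<eta>] inside the
    region where the second derivative is small; the bound by \<open>q\<close> controls the
    amplitude.\<close>
  define \<eta> where "\<eta> = min q (s / 2)"
  have \<eta>: "\<eta> > 0" "\<eta> < s" "\<eta> \<le> q"
    using q s by (auto simp: \<eta>_def)
  have lip: "\<bar>d x - d y\<bar> \<le> q\<^sup>2 / 2400000 * \<bar>x - y\<bar>" if "\<bar>x\<bar> \<le> \<eta>" "\<bar>y\<bar> \<le> \<eta>" for x y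
  proof -
    have "norm (d x - d y) \<le> q\<^sup>2 / 2400000 * norm (x - y)"
    proof (rule field_differentiable_bound[where S = "{-\<eta>..\<eta>}"])
      show "(d has_real_derivative deriv d z) (at z within {-\<eta>..\<eta>})" for z
        using d by (rule has_field_derivative_at_within)
      show "norm (deriv d z) \<le> q\<^sup>2 / 2400000" if "z \<in> {-\<eta>..\<eta>}" for z
        using that s(2)[of z] \<eta> by (auto simp: abs_less_iff)
    qed (use that in auto)
    then show ?thesis by simp
  qed
  \<comment> \<open>On either side of the strict minimum the mean value theorem yields a point where
    the derivative has the sign required by \<open>bifurcation\<close>.\<close>
  obtain a\<^sub>2 where a\<^sub>2: "0 < a\<^sub>2" "a\<^sub>2 < \<eta> / 2" "F (\<eta> / 2) - F 0 = (\<eta> / 2 - 0) * d a\<^sub>2"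
    using MVT2[of 0 "\<eta> / 2" F d] F \<eta> by auto
  then have pos: "d a\<^sub>2 > 0"
    using min[of "\<eta> / 2"] \<eta> by (smt (verit) mult_nonneg_nonpos)
  obtain a\<^sub>1 where a\<^sub>1: "- (\<eta> / 2) < a\<^sub>1" "a\<^sub>1 < 0" "F 0 - F (- (\<eta> / 2)) = (0 - - (\<eta> / 2)) * d a\<^sub>1"
    using MVT2[of "- (\<eta> / 2)" 0 F d] F \<eta> by auto
  then have neg: "d a\<^sub>1 < 0"
    using min[of "- (\<eta> / 2)"] \<eta> by (smt (verit) mult_nonneg_nonneg)
  obtain a r \<phi> where a: "\<bar>a\<bar> \<le> \<eta> / 2" and r: "0 < r" "r \<le> \<eta> / 4"
    and sl: "small_lipschitz q (increment d r a)" and \<phi>: "profile q (increment d r a) \<phi>"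
    and balance: "d a + r * average (\<lambda>x. increment d r a (\<phi> x)) = 0"
    by (rule bifurcation[OF q \<eta>(1) cont lip _ _ _ neg pos]) (use a\<^sub>1 a\<^sub>2 in auto)
  define u where "u x = a + r * \<phi> (sqrt (q / \<phi> 0) * x)" for x
  have u: "is_solution F q u" "nontrivial u" "periodic u"
    unfolding u_def
    using solution_of_profile[OF q r(1) cont[unfolded d_def] sl[unfolded d_def] \<phi>[unfolded d_def]
        balance[unfolded d_def]] by auto
  have le: "\<bar>u x\<bar> \<le> q" for x
  proof -
    \<comment> \<open>Together with \<open>\<bar>a\<bar> \<le> \<eta> / 2\<close> this gives at most
      13/16 of \<eta>, hence at most \<open>q\<close>.\<close>
    have "\<bar>r * \<phi> (sqrt (q / \<phi> 0) * x)\<bar> \<le> \<eta> / 4 * (5/4)"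
      unfolding abs_mult using r \<phi> near_cosD(3) by (intro mult_mono) (auto simp: profile_def)
    then show ?thesis
      using a \<eta> unfolding u_def by linarith
  qed
  have "sup_norm u \<le> q"
    unfolding sup_norm_def using le by (intro cSUP_least) auto
  \<comment> \<open>The pointwise bound also supplies the boundedness without which a real supremum
    need not dominate the values.\<close>
  moreover have "\<bar>u 0\<bar> \<le> sup_norm u"
    unfolding sup_norm_def using le by (intro cSUP_upper bdd_aboveI2) auto
  then have "0 \<le> sup_norm u"
    using abs_ge_zero[of "u 0"] by linarith
  ultimately show ?thesis
    using u by blast
qed

theorem theorem1p14:
  fixes F :: "real \<Rightarrow> real"
  assumes "C_k 2 F"
    and "Argmin F = {0}"
    and "Liminf at_infinity (\<lambda>t::real. ereal (F t / t\<^sup>2)) > 0"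
    and "(deriv ^^ 2) F 0 = 0"
  shows "\<exists>u :: real \<Rightarrow> real \<Rightarrow> real.
           (\<forall>q>0. is_solution F q (u q) \<and> nontrivial (u q) \<and> periodic (u q)) \<and>
           ((\<lambda>q. sup_norm (u q)) \<longlongrightarrow> 0) (at_right 0)"
proof -
  \<comment> \<open>One solution is chosen for each \<open>q\<close>; keeping the bound
    \<open>sup_norm (u q) \<le> q\<close> in the choice yields the limit by squeezing.\<close>
  obtain u where u: "\<And>q. q > 0 \<Longrightarrow> is_solution F q (u q) \<and> nontrivial (u q) \<and> periodic (u q) \<and>
      0 \<le> sup_norm (u q) \<and> sup_norm (u q) \<le> q"
    using small_solution_exists[OF assms(1,2,4)] by metis
  have "((\<lambda>q. sup_norm (u q)) \<longlongrightarrow> 0) (at_right 0)"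
  proof (rule tendsto_sandwich)
    show "\<forall>\<^sub>F q in at_right 0. 0 \<le> sup_norm (u q)" "\<forall>\<^sub>F q in at_right 0. sup_norm (u q) \<le> q"
      using u by (auto intro!: eventually_at_rightI[of 0 1])
  qed (auto intro: tendsto_ident_at)
  with u show ?thesis by blast
qed

end
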